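(* Let $N\in\{1,2,\dots\}$ and $\Omega:=\{0,1\}^N$. Let $\mathcal{E}_{\mathrm{Bern}}$ be the class of all e-functions on $\Omega$ with respect to the family $(B_p\mid p\in[0,1])$ of Bernoulli measures, let $\mathcal{E}_{\mathrm{exch}}$ be the class of all e-functions with respect to the family of all exchangeable probability measures on $\Omega$, and let $\mathcal{E}_{\mathrm{bin}}$ be the class of all e-functions on $\{0,\dots,N\}$ with respect to the family $(\mathrm{bin}_p\mid p\in[0,1])$ of binomial measures. Then $$\mathcal{E}_{\mathrm{Bern}}=\mathcal{E}_{\mathrm{exch}}\,\mathcal{E}_{\mathrm{bin}} .$$
   Context: An e-function with respect to a family of probability measures on a finite set $X$ (with the discrete $\sigma$-algebra) is a function $f:X\to[0,\infty]$ such that $\int f\,\mathrm{d}P\le1$ for every $P$ in the family. For $\omega\in\Omega=\{0,1\}^N$, $+\omega$ denotes the number of 1s in $\omega$. The Bernoulli measure $B_p$ on $\Omega$ with parameter $p\in[0,1]$ is defined by $B_p(\{\omega\}):=p^k(1-p)^{N-k}$ with $k:=+\omega$. The binomial measure $\mathrm{bin}_p$ on $\{0,\dots,N\}$ with parameter $p\in[0,1]$ is defined by $\mathrm{bin}_p(\{k\}):=\binom{N}{k}p^k(1-p)^{N-k}$. A probability measure $P$ on $\Omega$ is exchangeable if it is invariant under permutations of coordinates, equivalently if $P(\{\omega\})$ depends on $\omega$ only via $+\omega$. The product $\mathcal{E}_{\mathrm{exch}}\mathcal{E}_{\mathrm{bin}}$ is the set of all functions $\omega\in\Omega\mapsto g(\omega)h(+\omega)$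 with $g\in\mathcal{E}_{\mathrm{exch}}$ and $h\in\mathcal{E}_{\mathrm{bin}}$. *)

theory Defs
  imports "HOL-Probability.Probability"
begin

text \<open>
  Functions on a set \<open>X\<close> are represented by their extensional versions, so that equality of
  functions is equality on \<open>X\<close>. On \<^typ>\<open>ennreal\<close>, \<open>0 * \<infinity> = 0\<close>.
\<close>

definition e_functions :: "'a set \<Rightarrow> 'a measure set \<Rightarrow> ('a \<Rightarrow> ennreal) set" where
  "e_functions X \<P> = {f \<in> extensional X. \<forall>P\<in>\<P>. (\<integral>\<^sup>+ x. f x \<partial>P) \<le> 1}"

definition Omega :: "nat \<Rightarrow> (nat \<Rightarrow> nat) set" where
  "Omega N = ({..<N} \<rightarrow>\<^sub>E {0, 1})"

definition ones :: "nat \<Rightarrow> (nat \<Rightarrow> nat) \<Rightarrow> nat" where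
  "ones N \<omega> = card {i \<in> {..<N}. \<omega> i = 1}"

definition bernoulli_measure :: "nat \<Rightarrow> real \<Rightarrow> (nat \<Rightarrow> nat) measure" where
  "bernoulli_measure N p =
     point_measure (Omega N) (\<lambda>\<omega>. ennreal (p ^ ones N \<omega> * (1 - p) ^ (N - ones N \<omega>)))"

definition binomial_measure :: "nat \<Rightarrow> real \<Rightarrow> nat measure" where
  "binomial_measure N p =
     point_measure {0..N} (\<lambda>k. ennreal (real (N choose k) * p ^ k * (1 - p) ^ (N - k)))"

definition exchangeable :: "nat \<Rightarrow> (nat \<Rightarrow> nat) measure \<Rightarrow> bool" where
  "exchangeable N P \<longleftrightarrow>
     prob_space P \<and> sets P = Pow (Omega N) \<and>
     (\<forall>\<pi>. \<pi> permutes {..<N} \<longrightarrow> distr P P (\<lambda>\<omega>. \<omega> \<circ> \<pi>) = P)"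

definition E_Bern :: "nat \<Rightarrow> ((nat \<Rightarrow> nat) \<Rightarrow> ennreal) set" where
  "E_Bern N = e_functions (Omega N) {bernoulli_measure N p |p. p \<in> {0..1}}"

definition E_exch :: "nat \<Rightarrow> ((nat \<Rightarrow> nat) \<Rightarrow> ennreal) set" where
  "E_exch N = e_functions (Omega N) {P. exchangeable N P}"

definition E_bin :: "nat \<Rightarrow> (nat \<Rightarrow> ennreal) set" where
  "E_bin N = e_functions {0..N} {binomial_measure N p |p. p \<in> {0..1}}"

definition e_product ::
  "nat \<Rightarrow> ((nat \<Rightarrow> nat) \<Rightarrow> ennreal) set \<Rightarrow> (nat \<Rightarrow> ennreal) set \<Rightarrow> ((nat \<Rightarrow> nat) \<Rightarrow> ennreal) set"
  where
  "e_product N G H = {\<lambda>\<omega>\<in>Omega N. g \<omega> * h (ones N \<omega>) |g h. g \<in> G \<and> h \<in> H}"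

text \<open>
  The point masses above have total mass one, and an outcome permuted by its coordinates is
  again an outcome, so the image measure in \<^const>\<open>exchangeable\<close> is that of a measurable map.
\<close>

lemma finite_Omega: "finite (Omega N)"
  by (simp add: Omega_def finite_PiE)

lemma comp_permutes_in_Omega:
  assumes "\<pi> permutes {..<N}" "\<omega> \<in> Omega N"
  shows "\<omega> \<circ> \<pi> \<in> Omega N"
  using assms permutes_in_image[OF assms(1)] permutes_not_in[OF assms(1)]
  by (auto simp: Omega_def PiE_iff extensional_def)

lemma bernoulli_weight_eq_prod:
  assumes "\<omega> \<in> Omega N"
  shows "p ^ ones N \<omega> * (1 - p) ^ (N - ones N \<omega>) = (\<Prod>i<N. if \<omega> i = 1 then p else 1 - p)"
proof -
  have "card {i \<in> {..<N}. \<omega> i \<noteq> 1} = card ({..<N} - {i \<in> {..<N}. \<omega> i = 1})"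
    by (rule arg_cong[where f = card]) auto
  also have "\<dots> = N - ones N \<omega>"
    by (subst card_Diff_subset) (auto simp: ones_def)
  finally have "card {i \<in> {..<N}. \<omega> i \<noteq> 1} = N - ones N \<omega>" .
  moreover have "{..<N} \<inter> {i. \<omega> i = 1} = {i \<in> {..<N}. \<omega> i = 1}"
    and "{..<N} \<inter> - {i. \<omega> i = 1} = {i \<in> {..<N}. \<omega> i \<noteq> 1}"
    by auto
  ultimately show ?thesis
    by (simp add: prod.If_cases ones_def)
qed

lemma prob_space_bernoulli_measure:
  assumes "p \<in> {0..1}"
  shows "prob_space (bernoulli_measure N p)"
proof -
  have "(\<Sum>\<omega>\<in>Omega N. p ^ ones N \<omega> * (1 - p) ^ (N - ones N \<omega>)) =
        (\<Sum>\<omega>\<in>Omega N. \<Prod>i<N. if \<omega> i = 1 then p else 1 - p)"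
    by (intro sum.cong refl bernoulli_weight_eq_prod)
  also have "\<dots> = (\<Prod>i<N. \<Sum>j\<in>{0, 1::nat}. if j = 1 then p else 1 - p)"
    unfolding Omega_def by (subst prod_sum_PiE) auto
  also have "\<dots> = 1" by simp
  finally show ?thesis
    unfolding bernoulli_measure_def using assms
    by (intro prob_space_point_measure) (auto simp: finite_Omega)
qed

lemma prob_space_binomial_measure:
  assumes "p \<in> {0..1}"
  shows "prob_space (binomial_measure N p)"
proof -
  have "(\<Sum>k\<in>{0..N}. real (N choose k) * p ^ k * (1 - p) ^ (N - k)) = (p + (1 - p)) ^ N"
    by (simp only: binomial_ring atLeast0AtMost)
  then show ?thesis
    unfolding binomial_measure_def using assms
    by (intro prob_space_point_measure) auto
qed

lemma emeasure_binomial_measure: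
  assumes "p \<in> {0..1}" "A \<subseteq> {0..N}"
  shows "emeasure (binomial_measure N p) A = emeasure (measure_pmf (binomial_pmf N p)) A"
  using assms finite_subset[OF assms(2)]
  by (simp add: binomial_measure_def emeasure_point_measure_finite2 emeasure_measure_pmf_finite)

end

theory Submission
  imports Defs
begin

text \<open>
  Bernoulli measures and exchangeable measures on \<^term>\<open>Omega N\<close> weigh an outcome by a function of
  its number of ones only. So they see a function \<open>f\<close> on \<^term>\<open>Omega N\<close> only through its level
  averages \<open>k \<mapsto> \<langle>f\<rangle>\<^sub>k\<close>, the means of \<open>f\<close> over the outcomes with \<open>k\<close> ones
  (\<open>nn_integral_symmetric_weight\<close>). In these terms the two classes on \<^term>\<open>Omega N\<close> become simple:

  \<^item> \<open>f\<close> is a Bernoulli e-function iff \<open>k \<mapsto> \<langle>f\<rangle>\<^sub>k\<close> is a binomial e-function, because the number of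
    ones of a Bernoulli outcome is binomial (\<open>E_Bern_iff\<close>);
  \<^item> \<open>g\<close> is an exchangeability e-function iff \<open>\<langle>g\<rangle>\<^sub>k \<le> 1\<close> for all \<open>k\<close>, because the exchangeable
    probability measures are the mixtures of the uniform measures on the levels
    (\<open>E_exch_iff\<close>).

  Since \<open>\<langle>g \<cdot> (h \<circ> ones)\<rangle>\<^sub>k = \<langle>g\<rangle>\<^sub>k h k\<close>, a product is a Bernoulli e-function. Conversely a Bernoulli
  e-function \<open>f\<close> factors with \<open>h k = \<langle>f\<rangle>\<^sub>k\<close> and \<open>g = f / (h \<circ> ones)\<close>. The quotient is harmless: \<open>h\<close>
  vanishes at \<open>k\<close> only if \<open>f\<close> vanishes on the whole level, and \<open>f\<close> is finite since the fair coin
  charges every outcome.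
\<close>

section \<open>Levels and level averages\<close>

definition level :: "nat \<Rightarrow> nat \<Rightarrow> (nat \<Rightarrow> nat) set" where
  "level N k = {\<omega> \<in> Omega N. ones N \<omega> = k}"

definition level_avg :: "nat \<Rightarrow> ((nat \<Rightarrow> nat) \<Rightarrow> ennreal) \<Rightarrow> nat \<Rightarrow> ennreal" where
  "level_avg N f k = (\<Sum>\<omega>\<in>level N k. f \<omega>) / of_nat (N choose k)"

lemma finite_level: "finite (level N k)"
  by (simp add: level_def finite_Omega)

lemma ones_le: "ones N \<omega> \<le> N"
proof -
  have "card {i \<in> {..<N}. \<omega> i = 1} \<le> card {..<N}"
    by (rule card_mono) auto
  then show ?thesis by (simp add: ones_def)
qed

text \<open>An outcome is the indicator function of its set of successes.\<close>

lemma card_level: "card (level N k) = N choose k"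
proof -
  have "bij_betw (\<lambda>\<omega>. {i \<in> {..<N}. \<omega> i = 1}) (level N k) {A. A \<subseteq> {..<N} \<and> card A = k}"
  proof (rule bij_betw_byWitness[where f' = "\<lambda>A. \<lambda>i\<in>{..<N}. if i \<in> A then 1 else 0"])
    show "\<forall>\<omega>\<in>level N k. (\<lambda>i\<in>{..<N}. if i \<in> {i \<in> {..<N}. \<omega> i = 1} then 1 else 0) = \<omega>"
    proof
      fix \<omega> assume "\<omega> \<in> level N k"
      then have "\<omega> \<in> {..<N} \<rightarrow>\<^sub>E {0, 1}"
        by (simp add: level_def Omega_def)
      then show "(\<lambda>i\<in>{..<N}. if i \<in> {i \<in> {..<N}. \<omega> i = 1} then 1 else 0) = \<omega>"
        by (intro extensionalityI[of _ "{..<N}"]) (auto simp: PiE_iff)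
    qed
    have success: "{i \<in> {..<N}. (\<lambda>i\<in>{..<N}. if i \<in> A then 1 else 0) i = (1::nat)} = A"
      if "A \<subseteq> {..<N}" for A
      using that by (auto split: if_splits)
    show "\<forall>A\<in>{A. A \<subseteq> {..<N} \<and> card A = k}.
        {i \<in> {..<N}. (\<lambda>i\<in>{..<N}. if i \<in> A then 1 else 0) i = (1::nat)} = A"
      using success by blast
    show "(\<lambda>\<omega>. {i \<in> {..<N}. \<omega> i = 1}) ` level N k \<subseteq> {A. A \<subseteq> {..<N} \<and> card A = k}"
      by (auto simp: level_def ones_def)
    show "(\<lambda>A. \<lambda>i\<in>{..<N}. if i \<in> A then 1 else 0) ` {A. A \<subseteq> {..<N} \<and> card A = k} \<subseteq> level N k"
    proof
      fix \<omega> :: "nat \<Rightarrow> nat"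
      assume "\<omega> \<in> (\<lambda>A. \<lambda>i\<in>{..<N}. if i \<in> A then 1 else 0) ` {A. A \<subseteq> {..<N} \<and> card A = k}"
      then obtain A where A: "A \<subseteq> {..<N}" "card A = k"
        and \<omega>: "\<omega> = (\<lambda>i\<in>{..<N}. if i \<in> A then 1 else 0)"
        by blast
      have "ones N \<omega> = k"
        unfolding ones_def \<omega> success[OF A(1)] by (fact A(2))
      then show "\<omega> \<in> level N k"
        by (auto simp: level_def Omega_def \<omega>)
    qed
  qed
  then have "card (level N k) = card {A. A \<subseteq> {..<N} \<and> card A = k}"
    by (rule bij_betw_same_card)
  then show ?thesis
    by (simp add: n_subsets)
qed

lemma sum_level_eq_avg:
  assumes "k \<le> N"
  shows "(\<Sum>\<omega>\<in>level N k. f \<omega>) = of_nat (N choose k) * level_avg N f k"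
proof -
  have "of_nat (N choose k) \<noteq> (0::ennreal)"
    using assms by simp
  then show ?thesis
    by (simp add: level_avg_def ennreal_times_divide mult.commute[of "of_nat (N choose k)"]
        ennreal_mult_divide_eq)
qed

text \<open>The key identity for both families of measures on \<^term>\<open>Omega N\<close>: the weight is constant on
  each level, so the integral is summed level by level.\<close>

lemma nn_integral_symmetric_weight:
  "(\<integral>\<^sup>+ \<omega>. f \<omega> \<partial>point_measure (Omega N) (\<lambda>\<omega>. w (ones N \<omega>)))
    = (\<Sum>k\<in>{0..N}. w k * of_nat (N choose k) * level_avg N f k)"
proof -
  have "(\<integral>\<^sup>+ \<omega>. f \<omega> \<partial>point_measure (Omega N) (\<lambda>\<omega>. w (ones N \<omega>)))
      = (\<Sum>\<omega>\<in>Omega N. w (ones N \<omega>) * f \<omega>)"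
    by (rule nn_integral_point_measure_finite[OF finite_Omega])
  also have "\<dots> = (\<Sum>k\<in>{0..N}. \<Sum>\<omega>\<in>level N k. w (ones N \<omega>) * f \<omega>)"
    unfolding level_def
    by (rule sum.group[symmetric]) (auto simp: finite_Omega ones_le)
  also have "\<dots> = (\<Sum>k\<in>{0..N}. w k * (\<Sum>\<omega>\<in>level N k. f \<omega>))"
    by (intro sum.cong refl) (simp add: level_def sum_distrib_left)
  also have "\<dots> = (\<Sum>k\<in>{0..N}. w k * of_nat (N choose k) * level_avg N f k)"
    by (intro sum.cong refl) (simp add: sum_level_eq_avg mult.assoc)
  finally show ?thesis .
qed

lemma level_avg_mult_symmetric:
  "level_avg N (\<lambda>\<omega>\<in>Omega N. g \<omega> * h (ones N \<omega>)) k = level_avg N g k * h k"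
proof -
  have "(\<Sum>\<omega>\<in>level N k. (\<lambda>\<omega>\<in>Omega N. g \<omega> * h (ones N \<omega>)) \<omega>) = (\<Sum>\<omega>\<in>level N k. g \<omega>) * h k"
    unfolding sum_distrib_right by (intro sum.cong refl) (auto simp: level_def)
  then show ?thesis
    by (simp add: level_avg_def divide_ennreal_def mult_ac)
qed

lemma level_avg_one:
  assumes "k \<le> N"
  shows "level_avg N (\<lambda>_. 1) k = 1"
  using assms by (simp add: level_avg_def card_level less_top[symmetric])

section \<open>Bernoulli e-functions\<close>

text \<open>The number of ones of a Bernoulli outcome is binomial, and given that number the outcome is
  uniform on its level.\<close>

lemma nn_integral_bernoulli_measure:
  assumes "p \<in> {0..1}"
  shows "(\<integral>\<^sup>+ \<omega>. f \<omega> \<partial>bernoulli_measure N p) = (\<integral>\<^sup>+ k. level_avg N f k \<partial>binomial_measure N p)"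
proof -
  have "(\<integral>\<^sup>+ \<omega>. f \<omega> \<partial>bernoulli_measure N p)
      = (\<Sum>k\<in>{0..N}. ennreal (p ^ k * (1 - p) ^ (N - k)) * of_nat (N choose k) * level_avg N f k)"
    unfolding bernoulli_measure_def
    by (rule nn_integral_symmetric_weight[where w = "\<lambda>k. ennreal (p ^ k * (1 - p) ^ (N - k))"])
  also have "\<dots> =
      (\<Sum>k\<in>{0..N}. ennreal (real (N choose k) * p ^ k * (1 - p) ^ (N - k)) * level_avg N f k)"
    using assms
    by (intro sum.cong refl arg_cong2[where f = times])
      (simp add: ennreal_mult ennreal_of_nat_eq_real_of_nat mult_ac)
  also have "\<dots> = (\<integral>\<^sup>+ k. level_avg N f k \<partial>binomial_measure N p)"
    unfolding binomial_measure_def by (simp add: nn_integral_point_measure_finite)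
  finally show ?thesis .
qed

lemma nn_integral_binomial_measure_cong:
  assumes "\<And>k. k \<le> N \<Longrightarrow> h k = h' k"
  shows "(\<integral>\<^sup>+ k. h k \<partial>binomial_measure N p) = (\<integral>\<^sup>+ k. h' k \<partial>binomial_measure N p)"
  by (rule nn_integral_cong) (simp add: binomial_measure_def space_point_measure assms)

lemma E_Bern_iff:
  "f \<in> E_Bern N \<longleftrightarrow> f \<in> extensional (Omega N) \<and> restrict (level_avg N f) {0..N} \<in> E_bin N"
proof -
  have "integral\<^sup>N (binomial_measure N p) (restrict (level_avg N f) {0..N})
      = integral\<^sup>N (bernoulli_measure N p) f" if "p \<in> {0..1}" for p
    unfolding nn_integral_bernoulli_measure[OF that]
    by (rule nn_integral_binomial_measure_cong) simp
  then show ?thesis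
    unfolding E_Bern_def E_bin_def e_functions_def
    by (auto simp del: restrict_apply)
qed

text \<open>The fair coin gives every outcome positive probability.\<close>

lemma E_Bern_finite:
  assumes "f \<in> E_Bern N" and "\<omega> \<in> Omega N"
  shows "f \<omega> \<noteq> \<infinity>"
proof
  assume "f \<omega> = \<infinity>"
  have "(\<Sum>\<omega>\<in>Omega N. ennreal ((1/2) ^ ones N \<omega> * (1 - 1/2) ^ (N - ones N \<omega>)) * f \<omega>)
      = (\<integral>\<^sup>+ \<omega>. f \<omega> \<partial>bernoulli_measure N (1/2))"
    unfolding bernoulli_measure_def by (simp add: nn_integral_point_measure_finite finite_Omega)
  also have "\<dots> \<le> 1"
  proof -
    have "(1/2 :: real) \<in> {0..1}" by simp
    then show ?thesis
      using assms(1) unfolding E_Bern_def e_functions_def by blast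
  qed
  finally have sum_le: "(\<Sum>\<omega>\<in>Omega N.
      ennreal ((1/2) ^ ones N \<omega> * (1 - 1/2) ^ (N - ones N \<omega>)) * f \<omega>) \<le> 1" .
  have "ennreal ((1/2) ^ ones N \<omega> * (1 - 1/2) ^ (N - ones N \<omega>)) * f \<omega> \<le> 1"
    by (rule order_trans[OF member_le_sum[OF assms(2)] sum_le]) (auto simp: finite_Omega)
  then show False
    using \<open>f \<omega> = \<infinity>\<close> by (simp add: ennreal_mult_top top_unique)
qed

section \<open>Exchangeability e-functions\<close>

text \<open>Two outcomes with equally many ones take each value equally often.\<close>

lemma exists_permutation_of_same_ones:
  assumes "\<omega> \<in> Omega N" "\<omega>' \<in> Omega N" "ones N \<omega> = ones N \<omega>'"
  obtains \<pi> where "\<pi> permutes {..<N}" "\<omega>' \<circ> \<pi> = \<omega>"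
proof -
  have count: "count (image_mset \<alpha> (mset_set {..<N})) j
      = (if j = 1 then ones N \<alpha> else if j = 0 then N - ones N \<alpha> else 0)"
    if "\<alpha> \<in> Omega N" for \<alpha> j
  proof -
    have range: "\<alpha> i = 0 \<or> \<alpha> i = 1" if "i < N" for i
      using \<open>\<alpha> \<in> Omega N\<close> that by (auto simp: Omega_def PiE_iff)
    have "{i \<in> {..<N}. \<alpha> i = 0} = {..<N} - {i \<in> {..<N}. \<alpha> i = 1}"
      using range by auto
    also have "card \<dots> = N - ones N \<alpha>"
      by (subst card_Diff_subset) (auto simp: ones_def)
    finally have "card {i \<in> {..<N}. \<alpha> i = 0} = N - ones N \<alpha>" .
    moreover have "{i \<in> {..<N}. \<alpha> i = j} = {}" if "j \<noteq> 0" "j \<noteq> 1"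
      using range that by fastforce
    moreover have "count (image_mset \<alpha> (mset_set {..<N})) j = card {i \<in> {..<N}. \<alpha> i = j}"
      by (simp add: count_image_mset vimage_def Int_def conj_commute)
    ultimately show ?thesis
      by (simp only: ones_def) auto
  qed
  have "image_mset \<omega> (mset_set {..<N}) = image_mset \<omega>' (mset_set {..<N})"
    by (rule multiset_eqI) (simp only: count[OF assms(1)] count[OF assms(2)] assms(3))
  then obtain \<pi> where \<pi>: "\<pi> permutes {..<N}" "\<forall>i\<in>{..<N}. \<omega> i = \<omega>' (\<pi> i)"
    by (rule image_mset_eq_implies_permutes[OF finite_lessThan])
  have "\<omega>' \<circ> \<pi> = \<omega>"
    using comp_permutes_in_Omega[OF \<pi>(1) assms(2)] assms(1) \<pi>(2)
    by (intro extensionalityI[of _ "{..<N}"]) (auto simp: Omega_def PiE_iff)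
  with \<pi>(1) show ?thesis by (rule that)
qed

lemma ones_comp_permutes:
  assumes "\<pi> permutes {..<N}"
  shows "ones N (\<omega> \<circ> \<pi>) = ones N \<omega>"
proof -
  have "bij_betw \<pi> {i \<in> {..<N}. \<omega> (\<pi> i) = 1} {i \<in> {..<N}. \<omega> i = 1}"
  proof (rule bij_betw_byWitness[where f' = "inv \<pi>"])
    show "\<forall>i\<in>{i \<in> {..<N}. \<omega> (\<pi> i) = 1}. inv \<pi> (\<pi> i) = i"
      using assms by (simp add: permutes_inverses)
    show "\<forall>i\<in>{i \<in> {..<N}. \<omega> i = 1}. \<pi> (inv \<pi> i) = i"
      using assms by (simp add: permutes_inverses)
    show "\<pi> ` {i \<in> {..<N}. \<omega> (\<pi> i) = 1} \<subseteq> {i \<in> {..<N}. \<omega> i = 1}"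
      using permutes_in_image[OF assms] by auto
    show "inv \<pi> ` {i \<in> {..<N}. \<omega> i = 1} \<subseteq> {i \<in> {..<N}. \<omega> (\<pi> i) = 1}"
      using permutes_in_image[OF permutes_inv[OF assms]] permutes_inverses[OF assms] by auto
  qed
  then show ?thesis
    by (simp add: ones_def bij_betw_same_card)
qed

lemma vimage_comp_permutes:
  assumes "\<pi> permutes {..<N}" "\<omega> \<in> Omega N"
  shows "(\<lambda>\<alpha>. \<alpha> \<circ> \<pi>) -` {\<omega>} \<inter> Omega N = {\<omega> \<circ> inv \<pi>}"
proof -
  have "\<omega> \<circ> inv \<pi> \<in> Omega N"
    using assms by (intro comp_permutes_in_Omega permutes_inv)
  moreover have "\<omega> \<circ> inv \<pi> \<circ> \<pi> = \<omega>" "\<alpha> \<circ> \<pi> \<circ> inv \<pi> = \<alpha>" for \<alpha> :: "nat \<Rightarrow> nat"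
    by (simp_all add: comp_assoc permutes_inv_o[OF assms(1)])
  ultimately show ?thesis by (intro equalityI subsetI) (simp, metis, simp)
qed

lemma emeasure_distr_comp_permutes:
  assumes "sets P = Pow (Omega N)" "\<pi> permutes {..<N}" "\<omega> \<in> Omega N"
  shows "emeasure (distr P P (\<lambda>\<omega>. \<omega> \<circ> \<pi>)) {\<omega>} = emeasure P {\<omega> \<circ> inv \<pi>}"
proof -
  have space: "space P = Omega N"
    using sets_eq_imp_space_eq[of P "count_space (Omega N)"] assms(1) by simp
  have "(\<lambda>\<omega>. \<omega> \<circ> \<pi>) \<in> measurable P P"
    using comp_permutes_in_Omega[OF assms(2)]
    by (intro measurableI) (auto simp: assms(1) space)
  then show ?thesis
    using assms by (simp add: emeasure_distr vimage_comp_permutes space)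
qed

text \<open>The next two lemmas identify the exchangeable measures: the orbits of the coordinate
  permutations are the levels.\<close>

lemma exchangeable_symmetric_weight:
  assumes "prob_space (point_measure (Omega N) (\<lambda>\<omega>. w (ones N \<omega>)))"
  shows "exchangeable N (point_measure (Omega N) (\<lambda>\<omega>. w (ones N \<omega>)))" (is "exchangeable N ?P")
  unfolding exchangeable_def
proof (intro conjI allI impI)
  show "prob_space ?P" by (fact assms)
  show sets: "sets ?P = Pow (Omega N)" by (simp add: sets_point_measure)
  fix \<pi> assume \<pi>: "\<pi> permutes {..<N}"
  show "distr ?P ?P (\<lambda>\<omega>. \<omega> \<circ> \<pi>) = ?P"
  proof (rule measure_eqI_finite[OF _ sets finite_Omega])
    show "sets (distr ?P ?P (\<lambda>\<omega>. \<omega> \<circ> \<pi>)) = Pow (Omega N)" by (simp add: sets)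
    fix \<omega> assume \<omega>: "\<omega> \<in> Omega N"
    have inv: "inv \<pi> permutes {..<N}" using \<pi> by (rule permutes_inv)
    show "emeasure (distr ?P ?P (\<lambda>\<omega>. \<omega> \<circ> \<pi>)) {\<omega>} = emeasure ?P {\<omega>}"
      unfolding emeasure_distr_comp_permutes[OF sets \<pi> \<omega>]
      using \<omega> comp_permutes_in_Omega[OF inv \<omega>]
      by (simp add: emeasure_point_measure_finite2 ones_comp_permutes[OF inv])
  qed
qed

lemma exchangeable_imp_symmetric_weight:
  assumes "exchangeable N P"
  obtains w where "P = point_measure (Omega N) (\<lambda>\<omega>. w (ones N \<omega>))"
proof -
  have sets: "sets P = Pow (Omega N)"
    using assms by (simp add: exchangeable_def)
  have symmetric: "emeasure P {\<omega>} = emeasure P {\<omega>'}"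
    if \<omega>: "\<omega> \<in> Omega N" "\<omega>' \<in> Omega N" "ones N \<omega> = ones N \<omega>'" for \<omega> \<omega>'
  proof -
    obtain \<pi> where \<pi>: "\<pi> permutes {..<N}" "\<omega>' \<circ> \<pi> = \<omega>"
      using exists_permutation_of_same_ones[OF \<omega>] .
    have "\<omega> \<circ> inv \<pi> = \<omega>'"
      unfolding \<pi>(2)[symmetric] by (simp add: comp_assoc permutes_inv_o[OF \<pi>(1)])
    moreover have "emeasure (distr P P (\<lambda>\<omega>. \<omega> \<circ> \<pi>)) {\<omega>} = emeasure P {\<omega>}"
      using assms \<pi>(1) by (simp add: exchangeable_def)
    ultimately show ?thesis
      by (simp add: emeasure_distr_comp_permutes[OF sets \<pi>(1) \<omega>(1)])
  qed
  \<comment> \<open>By symmetry the choice of the representative does not matter.\<close>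
  define w where "w k = emeasure P {SOME \<omega>. \<omega> \<in> level N k}" for k
  have w: "w (ones N \<omega>) = emeasure P {\<omega>}" if "\<omega> \<in> Omega N" for \<omega>
  proof -
    have "(SOME \<alpha>. \<alpha> \<in> level N (ones N \<omega>)) \<in> level N (ones N \<omega>)"
      by (rule someI[where P = "\<lambda>\<alpha>. \<alpha> \<in> level N (ones N \<omega>)" and x = \<omega>])
        (simp add: level_def that)
    then show ?thesis
      unfolding w_def using that by (intro symmetric) (auto simp: level_def)
  qed
  have "P = point_measure (Omega N) (\<lambda>\<omega>. w (ones N \<omega>))"
    by (rule measure_eqI_finite[OF sets _ finite_Omega])
      (simp_all add: sets_point_measure emeasure_point_measure_finite2 w)
  then show ?thesis by (rule that)
qed

lemma prob_space_symmetric_weight_iff: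
  "prob_space (point_measure (Omega N) (\<lambda>\<omega>. w (ones N \<omega>)))
    \<longleftrightarrow> (\<Sum>k\<in>{0..N}. w k * of_nat (N choose k)) = 1" (is "prob_space ?P \<longleftrightarrow> _")
proof -
  have "emeasure ?P (space ?P) = (\<integral>\<^sup>+ \<omega>. 1 \<partial>?P)"
    by simp
  also have "\<dots> = (\<Sum>k\<in>{0..N}. w k * of_nat (N choose k))"
    unfolding nn_integral_symmetric_weight by (intro sum.cong refl) (simp add: level_avg_one)
  finally show ?thesis
    by (auto intro: prob_spaceI dest: prob_space.emeasure_space_1)
qed

text \<open>The bound is necessary because the uniform measure on each level is exchangeable, and
  sufficient because the integral over an exchangeable measure is a convex combination of level
  averages.\<close>

lemma E_exch_iff:
  "g \<in> E_exch N \<longleftrightarrow> g \<in> extensional (Omega N) \<and> (\<forall>k\<le>N. level_avg N g k \<le> 1)"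
proof (intro iffI conjI allI impI)
  assume g: "g \<in> E_exch N"
  then show "g \<in> extensional (Omega N)"
    by (simp add: E_exch_def e_functions_def)
  fix k assume k: "k \<le> N"
  \<comment> \<open>the weight of the uniform measure on the level \<open>k\<close>\<close>
  define w where "w j = (if j = k then 1 / of_nat (N choose k) else 0 :: ennreal)" for j
  let ?U = "point_measure (Omega N) (\<lambda>\<omega>. w (ones N \<omega>))"
  have w: "w j * of_nat (N choose j) = (if j = k then 1 else 0)" for j
    using k by (simp add: w_def ennreal_divide_times less_top[symmetric])
  have "prob_space ?U"
    unfolding prob_space_symmetric_weight_iff w using k by simp
  then have "exchangeable N ?U"
    by (rule exchangeable_symmetric_weight)
  then have "(\<integral>\<^sup>+ \<omega>. g \<omega> \<partial>?U) \<le> 1"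
    using g by (simp add: E_exch_def e_functions_def)
  then show "level_avg N g k \<le> 1"
    unfolding nn_integral_symmetric_weight w using k by (simp add: if_distrib[of "\<lambda>x. x * _"] cong: if_cong)
next
  assume g: "g \<in> extensional (Omega N) \<and> (\<forall>k\<le>N. level_avg N g k \<le> 1)"
  have "(\<integral>\<^sup>+ \<omega>. g \<omega> \<partial>P) \<le> 1" if P: "exchangeable N P" for P
  proof -
    obtain w where w: "P = point_measure (Omega N) (\<lambda>\<omega>. w (ones N \<omega>))"
      using exchangeable_imp_symmetric_weight[OF P] .
    have "(\<integral>\<^sup>+ \<omega>. g \<omega> \<partial>P) = (\<Sum>k\<in>{0..N}. w k * of_nat (N choose k) * level_avg N g k)"
      unfolding w by (rule nn_integral_symmetric_weight)
    also have "\<dots> \<le> (\<Sum>k\<in>{0..N}. w k * of_nat (N choose k) * 1)"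
      using g by (intro sum_mono mult_left_mono) auto
    also have "\<dots> = 1"
      using P by (simp add: w exchangeable_def prob_space_symmetric_weight_iff)
    finally show ?thesis .
  qed
  then show "g \<in> E_exch N"
    using g by (simp add: E_exch_def e_functions_def)
qed

section \<open>The factorization\<close>

lemma E_product_subset_E_Bern: "e_product N (E_exch N) (E_bin N) \<subseteq> E_Bern N"
proof
  fix f assume "f \<in> e_product N (E_exch N) (E_bin N)"
  then obtain g h where f: "f = (\<lambda>\<omega>\<in>Omega N. g \<omega> * h (ones N \<omega>))"
    and g: "g \<in> E_exch N" and h: "h \<in> E_bin N"
    by (auto simp: e_product_def)
  have "integral\<^sup>N (bernoulli_measure N p) f \<le> 1" if p: "p \<in> {0..1}" for p
  proof -
    have "(\<integral>\<^sup>+ \<omega>. f \<omega> \<partial>bernoulli_measure N p)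
        = (\<integral>\<^sup>+ k. level_avg N g k * h k \<partial>binomial_measure N p)"
      unfolding nn_integral_bernoulli_measure[OF p] f level_avg_mult_symmetric ..
    also have "\<dots> \<le> (\<integral>\<^sup>+ k. h k \<partial>binomial_measure N p)"
    proof (rule nn_integral_mono)
      fix k assume "k \<in> space (binomial_measure N p)"
      then have "level_avg N g k \<le> 1"
        using g by (simp add: E_exch_iff binomial_measure_def space_point_measure)
      then show "level_avg N g k * h k \<le> h k"
        using mult_right_mono[of "level_avg N g k" 1 "h k"] by simp
    qed
    also have "\<dots> \<le> 1"
      using h p unfolding E_bin_def e_functions_def by blast
    finally show ?thesis .
  qed
  then show "f \<in> E_Bern N"
    unfolding E_Bern_def e_functions_def
    by (auto simp: f simp del: restrict_apply)
qed

lemma E_Bern_subset_E_product: "E_Bern N \<subseteq> e_product N (E_exch N) (E_bin N)"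
proof
  fix f assume f: "f \<in> E_Bern N"
  define h where "h = restrict (level_avg N f) {0..N}"
  \<comment> \<open>Where \<open>h\<close> vanishes, so does \<open>f\<close>, and \<open>g\<close> is \<open>0 * \<infinity> = 0\<close>.\<close>
  define g where "g = (\<lambda>\<omega>\<in>Omega N. f \<omega> * (1 / h (ones N \<omega>)))"
  have h: "h \<in> E_bin N"
    using f by (simp add: h_def E_Bern_iff)
  have h_finite: "h k \<noteq> \<infinity>" if "k \<le> N" for k
  proof -
    have "(\<Sum>\<omega>\<in>level N k. f \<omega>) \<noteq> \<infinity>"
      using E_Bern_finite[OF f] by (simp add: level_def finite_Omega)
    then show ?thesis
      using that by (simp add: h_def level_avg_def ennreal_divide_eq_top_iff)
  qed
  have vanish: "f \<omega> = 0" if "\<omega> \<in> Omega N" "h (ones N \<omega>) = 0" for \<omega>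
  proof -
    have "(\<Sum>\<alpha>\<in>level N (ones N \<omega>). f \<alpha>) = 0"
      using that(2) by (simp add: h_def ones_le level_avg_def)
    then show ?thesis
      using that(1) by (simp add: finite_level level_def finite_Omega)
  qed
  have "level_avg N g k \<le> 1" if k: "k \<le> N" for k
  proof -
    have "level_avg N g k = h k * (1 / h k)"
      unfolding g_def level_avg_mult_symmetric[where h = "\<lambda>k. 1 / h k"] using k by (simp add: h_def)
    then show ?thesis
      using h_finite[OF k] by (cases "h k = 0") (simp_all add: ennreal_times_divide less_top[symmetric])
  qed
  then have g: "g \<in> E_exch N"
    by (simp add: E_exch_iff g_def)
  have "f \<omega> = g \<omega> * h (ones N \<omega>)" if \<omega>: "\<omega> \<in> Omega N" for \<omega>
  proof (cases "h (ones N \<omega>) = 0")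
    case True
    then show ?thesis using vanish[OF \<omega>] by simp
  next
    case False
    then show ?thesis
      using h_finite[OF ones_le, of \<omega>] \<omega>
      by (simp add: g_def ennreal_times_divide ennreal_divide_times less_top[symmetric])
  qed
  moreover have "f \<in> extensional (Omega N)"
    using f by (simp add: E_Bern_iff)
  ultimately have "f = (\<lambda>\<omega>\<in>Omega N. g \<omega> * h (ones N \<omega>))"
    by (intro extensionalityI[of _ "Omega N"]) auto
  then show "f \<in> e_product N (E_exch N) (E_bin N)"
    using g h by (auto simp: e_product_def)
qed

theorem corollary16:
  fixes N :: nat
  assumes "N \<ge> 1"
  shows "E_Bern N = e_product N (E_exch N) (E_bin N)"
  using E_Bern_subset_E_product E_product_subset_E_Bern by (rule subset_antisym)

end
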